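(* Let $(W,S)$ be a Coxeter system and let $u,v\in W$ be such that $u\leq_R v$. Then $$T_L(v)=T_L(u)\,\cup\,\bigcup_{s\in D_R(u^{-1}v)}T_L\left(v^{S\setminus\{s\}}\right).$$
   Context: $(W,S)$ is a Coxeter system: $W$ is the group with generating set $S$ (not assumed finite) and relations $(st)^{m(s,t)}=e$ for $s,t\in S$, where $m:S\times S\to\{1,2,\ldots,\infty\}$ is a symmetric Coxeter matrix with $m(s,t)=1$ if and only if $s=t$ (the value $\infty$ means no relation is imposed). The length function is $\ell:W\to\mathbb{N}$, where $\ell(w)$ is the minimal length of a word in $S$ representing $w$. The set of reflections is $T:=\{wsw^{-1}: w\in W,\ s\in S\}$. For $w\in W$, $T_L(w):=\{t\in T:\ell(tw)<\ell(w)\}$ and $D_R(w):=\{s\in S:\ell(ws)<\ell(w)\}$. The right weak order $\leq_R$ on $W$ is the partial order whose covering relations are: $v$ covers $u$ if and only if $\ell(u)<\ell(v)$ and $u^{-1}v\in S$. For $J\subseteq S$, $W_J$ is the subgroup of $W$ generated by $J$, and $w^J$ denotes the unique element of minimal length in the coset $wW_J$. *)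

theory Defs
  imports "HOL-Algebra.Algebra" "HOL-Library.Extended_Nat"
begin

text \<open>
  Group words over a set \<open>S\<close> of generators are lists of signed letters:
  \<open>(s, True)\<close> stands for \<open>s\<close> and \<open>(s, False)\<close> for the formal inverse of \<open>s\<close>.
\<close>

type_synonym 'a group_word = "('a \<times> bool) list"

definition group_words :: "'a set \<Rightarrow> 'a group_word set" where
  "group_words S = lists (S \<times> UNIV)"

text \<open>
  The congruence on group words whose quotient is the group \<open>\<langle>S | R\<rangle>\<close>: it is generated by
  free cancellation and by deletion of relators.
\<close>

inductive word_equiv :: "'a set \<Rightarrow> 'a group_word set \<Rightarrow> 'a group_word \<Rightarrow> 'a group_word \<Rightarrow> bool"
  for S R where
  refl: "x \<in> group_words S \<Longrightarrow> word_equiv S R x x"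
| sym: "word_equiv S R x y \<Longrightarrow> word_equiv S R y x"
| trans: "word_equiv S R x y \<Longrightarrow> word_equiv S R y z \<Longrightarrow> word_equiv S R x z"
| cancel: "x \<in> group_words S \<Longrightarrow> y \<in> group_words S \<Longrightarrow> s \<in> S \<Longrightarrow>
    word_equiv S R (x @ [(s, b), (s, \<not> b)] @ y) (x @ y)"
| relator: "x \<in> group_words S \<Longrightarrow> y \<in> group_words S \<Longrightarrow> r \<in> R \<Longrightarrow>
    word_equiv S R (x @ r @ y) (x @ y)"

definition word_eval :: "('a, 'b) monoid_scheme \<Rightarrow> 'a group_word \<Rightarrow> 'a" where
  "word_eval G x =
     foldr (\<lambda>(s, b) g. (if b then s else inv\<^bsub>G\<^esub> s) \<otimes>\<^bsub>G\<^esub> g) x \<one>\<^bsub>G\<^esub>"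

text \<open>
  \<open>G\<close> has the presentation \<open>\<langle>S | R\<rangle>\<close>: evaluation of words induces an isomorphism from the
  quotient by \<^const>\<open>word_equiv\<close> onto \<open>G\<close>.
\<close>

definition has_presentation ::
  "('a, 'b) monoid_scheme \<Rightarrow> 'a set \<Rightarrow> 'a group_word set \<Rightarrow> bool" where
  "has_presentation G S R \<longleftrightarrow>
     S \<subseteq> carrier G \<and> generate G S = carrier G \<and>
     (\<forall>x \<in> group_words S. \<forall>y \<in> group_words S.
        word_eval G x = word_eval G y \<longleftrightarrow> word_equiv S R x y)"

definition coxeter_matrix :: "'a set \<Rightarrow> ('a \<Rightarrow> 'a \<Rightarrow> enat) \<Rightarrow> bool" where
  "coxeter_matrix S m \<longleftrightarrow>
     (\<forall>s \<in> S. \<forall>t \<in> S. 1 \<le> m s t \<and> m s t = m t s \<and> (m s t = 1 \<longleftrightarrow> s = t))"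

text \<open>The words \<open>(s t)\<^sup>k\<close> with \<open>k = m(s,t)\<close> finite.\<close>

definition coxeter_relators :: "'a set \<Rightarrow> ('a \<Rightarrow> 'a \<Rightarrow> enat) \<Rightarrow> 'a group_word set" where
  "coxeter_relators S m =
     {concat (replicate k [(s, True), (t, True)]) | s t k. s \<in> S \<and> t \<in> S \<and> m s t = enat k}"

locale coxeter_system = group W for W (structure) +
  fixes S :: "'a set" and m :: "'a \<Rightarrow> 'a \<Rightarrow> enat"
  assumes matrix: "coxeter_matrix S m"
    and presentation: "has_presentation W S (coxeter_relators S m)"

definition cox_length :: "('a, 'b) monoid_scheme \<Rightarrow> 'a set \<Rightarrow> 'a \<Rightarrow> nat" where
  "cox_length W S w =
     (LEAST n. \<exists>x. set x \<subseteq> S \<and> length x = n \<and> foldr (\<otimes>\<^bsub>W\<^esub>) x \<one>\<^bsub>W\<^esub> = w)"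

definition reflections :: "('a, 'b) monoid_scheme \<Rightarrow> 'a set \<Rightarrow> 'a set" where
  "reflections W S = {w \<otimes>\<^bsub>W\<^esub> s \<otimes>\<^bsub>W\<^esub> inv\<^bsub>W\<^esub> w | w s. w \<in> carrier W \<and> s \<in> S}"

definition left_inversions :: "('a, 'b) monoid_scheme \<Rightarrow> 'a set \<Rightarrow> 'a \<Rightarrow> 'a set" where
  "left_inversions W S w =
     {t \<in> reflections W S. cox_length W S (t \<otimes>\<^bsub>W\<^esub> w) < cox_length W S w}"

definition right_descents :: "('a, 'b) monoid_scheme \<Rightarrow> 'a set \<Rightarrow> 'a \<Rightarrow> 'a set" where
  "right_descents W S w = {s \<in> S. cox_length W S (w \<otimes>\<^bsub>W\<^esub> s) < cox_length W S w}"

definition right_weak_covers ::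
  "('a, 'b) monoid_scheme \<Rightarrow> 'a set \<Rightarrow> 'a \<Rightarrow> 'a \<Rightarrow> bool" where
  "right_weak_covers W S u v \<longleftrightarrow>
     u \<in> carrier W \<and> v \<in> carrier W \<and>
     cox_length W S u < cox_length W S v \<and> inv\<^bsub>W\<^esub> u \<otimes>\<^bsub>W\<^esub> v \<in> S"

text \<open>
  The order with the above covering relations is their reflexive transitive closure; as a
  relation on the whole type it is also reflexive outside the carrier.
\<close>

definition right_weak_le :: "('a, 'b) monoid_scheme \<Rightarrow> 'a set \<Rightarrow> 'a \<Rightarrow> 'a \<Rightarrow> bool" where
  "right_weak_le W S = (right_weak_covers W S)\<^sup>*\<^sup>*"

definition min_coset_rep ::
  "('a, 'b) monoid_scheme \<Rightarrow> 'a set \<Rightarrow> 'a set \<Rightarrow> 'a \<Rightarrow> 'a" where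
  "min_coset_rep W S J w =
     (THE x. x \<in> w <#\<^bsub>W\<^esub> generate W J \<and>
        (\<forall>y \<in> w <#\<^bsub>W\<^esub> generate W J. cox_length W S x \<le> cox_length W S y))"

end

theory Submission
  imports Defs
begin

text \<open>
  The proof replaces lengths by sets of reflections. A word \<open>s\<^sub>1 \<dots> s\<^sub>n\<close> in \<open>S\<close> yields the
  reflections \<open>t\<^sub>i = s\<^sub>1 \<dots> s\<^sub>i \<dots> s\<^sub>1\<close>. How often a given \<open>t\<close> occurs among them is, modulo 2,
  unchanged by the Coxeter relations (\<open>odd_count_invariant\<close>), so the set \<open>N(w)\<close> of those \<open>t\<close>
  that occur an odd number of times depends only on the element \<open>w\<close>. Three properties of
  \<open>N\<close> carry the argument: it is a cocycle, \<open>N(a b) = N(a) \<triangle> a N(b) a\<inverse>\<close>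
  (\<open>inversions_mult\<close>); its cardinality is the length (\<open>cox_length_eq_card\<close>); and it equals
  \<open>T\<^sub>L(w)\<close> (\<open>left_inversions_eq\<close>).

  A step \<open>u \<lhd> u s\<close> of the right weak order adjoins the single element \<open>u s u\<inverse>\<close> to \<open>N(u)\<close>,
  so \<open>N\<close> is monotone. An element \<open>x\<close> that is minimal in \<open>x W\<^sub>J\<close> satisfies
  \<open>N(x y) = N(x) \<uplus> x N(y) x\<inverse>\<close> for \<open>y \<in> W\<^sub>J\<close> (\<open>coset_minimal_inversions\<close>); in
  particular \<open>N(v\<^sup>J) \<subseteq> N(v)\<close>. This gives one inclusion.

  For the other, put \<open>w = u\<inverse> v\<close> and let \<open>t \<in> N(v) - N(u)\<close>. By the cocycle identity,
  \<open>t' = u\<inverse> t u\<close> lies in \<open>N(w)\<close>, so \<open>r = v\<inverse> t v = w\<inverse> t' w\<close> is a reflection that shortens \<open>w\<close>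
  from the right. If \<open>t \<notin> N(v\<^sup>J)\<close>, then \<open>t \<in> v\<^sup>J N(y) (v\<^sup>J)\<inverse>\<close> where \<open>v = v\<^sup>J y\<close>, and hence
  \<open>r \<in> W\<^sub>J\<close>. Were this so for \<open>J = S - {s}\<close> with every \<open>s \<in> D\<^sub>R(w)\<close>, then \<open>r\<close> would lie in the
  intersection of these subgroups, which is \<open>W\<^sub>K\<close> with \<open>K = S - D\<^sub>R(w)\<close>, because the letters of
  a reduced word of an element of \<open>W\<^sub>J\<close> all belong to \<open>J\<close> (\<open>reduced_word_letters\<close>). But \<open>w\<close> has
  no descent in \<open>K\<close>, so it is minimal in \<open>w W\<^sub>K\<close> (\<open>coset_minimal_if_no_descent\<close>) and \<open>r\<close> cannot
  shorten it.
\<close>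

section \<open>Words and their reflections\<close>

context coxeter_system
begin

abbreviation word_prod :: "'a list \<Rightarrow> 'a" where
  "word_prod x \<equiv> foldr (\<otimes>) x \<one>"

definition conj_by :: "'a \<Rightarrow> 'a \<Rightarrow> 'a" where
  "conj_by g t = g \<otimes> t \<otimes> inv g"

primrec refl_list :: "'a list \<Rightarrow> 'a list" where
  "refl_list [] = []"
| "refl_list (s # x) = s # map (conj_by s) (refl_list x)"

lemma gen_carrier: "s \<in> S \<Longrightarrow> s \<in> carrier W"
  using presentation by (auto simp: has_presentation_def)

lemma word_prod_closed [simp]: "set x \<subseteq> S \<Longrightarrow> word_prod x \<in> carrier W"
  by (induction x) (auto simp: gen_carrier)

lemma word_prod_append:
  "set x \<subseteq> S \<Longrightarrow> set y \<subseteq> S \<Longrightarrow> word_prod (x @ y) = word_prod x \<otimes> word_prod y"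
  by (induction x) (auto simp: gen_carrier m_assoc)

lemma conj_by_closed [simp]: "g \<in> carrier W \<Longrightarrow> t \<in> carrier W \<Longrightarrow> conj_by g t \<in> carrier W"
  by (simp add: conj_by_def)

lemma conj_by_mult:
  "g \<in> carrier W \<Longrightarrow> h \<in> carrier W \<Longrightarrow> t \<in> carrier W \<Longrightarrow>
    conj_by (g \<otimes> h) t = conj_by g (conj_by h t)"
  by (simp add: conj_by_def m_assoc inv_mult_group)

lemma conj_by_one [simp]: "t \<in> carrier W \<Longrightarrow> conj_by \<one> t = t"
  by (simp add: conj_by_def)

lemma conj_by_inv_cancel [simp]:
  assumes "g \<in> carrier W" "t \<in> carrier W"
  shows "conj_by (inv g) (conj_by g t) = t" "conj_by g (conj_by (inv g) t) = t"
  using assms by (simp_all add: conj_by_mult [symmetric])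

lemma conj_by_eq_iff:
  "g \<in> carrier W \<Longrightarrow> a \<in> carrier W \<Longrightarrow> t \<in> carrier W \<Longrightarrow>
    conj_by g a = t \<longleftrightarrow> a = conj_by (inv g) t"
  by auto

lemma conj_by_self [simp]: "g \<in> carrier W \<Longrightarrow> conj_by g g = g"
  by (simp add: conj_by_def m_assoc)

lemma conj_by_inv_self [simp]: "g \<in> carrier W \<Longrightarrow> conj_by (inv g) g = g"
  by (simp add: conj_by_def)

lemma conj_by_mult_right:
  "g \<in> carrier W \<Longrightarrow> t \<in> carrier W \<Longrightarrow> a \<in> carrier W \<Longrightarrow>
    conj_by g t \<otimes> (g \<otimes> a) = g \<otimes> (t \<otimes> a)"
  by (simp add: conj_by_def m_assoc inv_solve_left')

lemma conj_by_inv_mult_right: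
  "g \<in> carrier W \<Longrightarrow> t \<in> carrier W \<Longrightarrow> g \<otimes> conj_by (inv g) t = t \<otimes> g"
  by (simp add: conj_by_def m_assoc [symmetric])

lemma refl_list_closed: "set x \<subseteq> S \<Longrightarrow> set (refl_list x) \<subseteq> carrier W"
  by (induction x) (auto simp: gen_carrier)

lemma length_refl_list [simp]: "length (refl_list x) = length x"
  by (induction x) auto

lemma refl_list_append:
  "set x \<subseteq> S \<Longrightarrow> set y \<subseteq> S \<Longrightarrow>
    refl_list (x @ y) = refl_list x @ map (conj_by (word_prod x)) (refl_list y)"
proof (induction x)
  case Nil
  then show ?case using refl_list_closed [of y] by (auto intro!: map_idI [symmetric])
next
  case (Cons s x)
  then show ?case using refl_list_closed [of y]
    by (auto simp: conj_by_mult gen_carrier)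
qed

lemma count_list_map_conj_by:
  "set l \<subseteq> carrier W \<Longrightarrow> g \<in> carrier W \<Longrightarrow> t \<in> carrier W \<Longrightarrow>
    count_list (map (conj_by g) l) t = count_list l (conj_by (inv g) t)"
  by (induction l) (auto simp: conj_by_eq_iff)

lemma count_refl_list_append:
  "set x \<subseteq> S \<Longrightarrow> set y \<subseteq> S \<Longrightarrow> t \<in> carrier W \<Longrightarrow>
    count_list (refl_list (x @ y)) t =
      count_list (refl_list x) t + count_list (refl_list y) (conj_by (inv (word_prod x)) t)"
  by (simp add: refl_list_append count_list_map_conj_by refl_list_closed)

section \<open>The parity of reflection counts\<close>

lemma coxeter_relation:
  assumes "s \<in> S" "t \<in> S" "m s t = enat k"
  shows "(s \<otimes> t) [^] k = \<one>"
proof -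
  let ?r = "\<lambda>k. concat (replicate k [(s, True), (t, True)])"
  have gw: "?r k \<in> group_words S" for k :: nat
    using assms by (auto simp: group_words_def split: if_splits)
  have "?r k \<in> coxeter_relators S m" using assms by (auto simp: coxeter_relators_def)
  then have "word_equiv S (coxeter_relators S m) ([] @ ?r k @ []) ([] @ [])"
    by (intro word_equiv.relator) (auto simp: group_words_def)
  then have "word_eval W (?r k) = word_eval W []"
    using presentation gw [of k] by (auto simp: has_presentation_def group_words_def)
  moreover have "word_eval W (?r k) = (s \<otimes> t) [^] k" for k :: nat
  proof (induction k)
    case (Suc k)
    have "(s \<otimes> t) [^] Suc k = (s \<otimes> t) \<otimes> (s \<otimes> t) [^] k"
      using assms by (intro nat_pow_Suc2) (simp add: gen_carrier)
    then show ?case using assms Suc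
      by (simp add: word_eval_def gen_carrier m_assoc del: nat_pow_Suc)
  qed (simp add: word_eval_def)
  ultimately show ?thesis by (simp add: word_eval_def)
qed

lemma gen_involution: "s \<in> S \<Longrightarrow> s \<otimes> s = \<one>"
  using coxeter_relation [of s s 1] matrix
  by (auto simp: coxeter_matrix_def one_enat_def gen_carrier)

lemma gen_inv [simp]: "s \<in> S \<Longrightarrow> inv s = s"
  using gen_involution inv_equality gen_carrier by blast

lemma gen_cancel [simp]: "s \<in> S \<Longrightarrow> a \<in> carrier W \<Longrightarrow> s \<otimes> (s \<otimes> a) = a"
  by (simp add: m_assoc [symmetric] gen_carrier gen_involution)

lemma word_prod_alternating:
  "s \<in> S \<Longrightarrow> t \<in> S \<Longrightarrow> word_prod (concat (replicate k [s, t])) = (s \<otimes> t) [^] k"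
proof (induction k)
  case (Suc k)
  have "(s \<otimes> t) [^] Suc k = (s \<otimes> t) \<otimes> (s \<otimes> t) [^] k"
    using Suc.prems by (intro nat_pow_Suc2) (simp add: gen_carrier)
  then show ?case using Suc by (simp add: gen_carrier m_assoc del: nat_pow_Suc)
qed simp

lemma refl_list_alternating:
  assumes "s \<in> S" "t \<in> S"
  shows "refl_list (concat (replicate k [s, t])) = map (\<lambda>i. (s \<otimes> t) [^] i \<otimes> s) [0..<2 * k]"
proof (induction k)
  case (Suc k)
  have [simp]: "s \<in> carrier W" "t \<in> carrier W" using assms gen_carrier by auto
  have shift: "conj_by s (conj_by t ((s \<otimes> t) [^] i \<otimes> s)) = (s \<otimes> t) [^] (i + 2) \<otimes> s" for i :: nat
  proof -
    have "conj_by s (conj_by t (p \<otimes> s)) = (s \<otimes> t) \<otimes> (p \<otimes> (s \<otimes> t)) \<otimes> s"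
      if "p \<in> carrier W" for p
      using assms that by (simp add: conj_by_def m_assoc)
    moreover have "(s \<otimes> t) \<otimes> ((s \<otimes> t) [^] i \<otimes> (s \<otimes> t)) = (s \<otimes> t) [^] (i + 2)"
      using nat_pow_Suc [of "s \<otimes> t" i] nat_pow_Suc2 [of "s \<otimes> t" "Suc i"] by auto
    ultimately show ?thesis by simp
  qed
  have "conj_by s t = (s \<otimes> t) [^] (1 :: nat) \<otimes> s"
    using assms by (simp add: conj_by_def)
  moreover have "[0..<2 * Suc k] = 0 # 1 # map (\<lambda>i. i + 2) [0..<2 * k]"
  proof -
    have "[0..<2 * Suc k] = [0..<2] @ [2..<2 * k + 2]"
      using upt_add_eq_append [of 0 2 "2 * k"] by (simp add: add.commute del: upt_Suc)
    moreover have "[0..<2] = [0, 1]" by (simp add: numeral_2_eq_2)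
    moreover have "map (\<lambda>i. i + 2) [0..<2 * k] = [2..<2 * k + 2]" by (rule map_add_upt)
    ultimately show ?thesis by (simp only: append_Cons append_Nil)
  qed
  ultimately show ?case by (simp add: Suc.IH shift o_def del: upt_Suc nat_pow_Suc)
qed simp

text \<open>
  In the word \<open>(s t)\<^sup>k\<close> the \<open>i\<close>-th reflection, counted from 0, is \<open>(s t)\<^sup>i s\<close>. When \<open>(s t)\<^sup>k = e\<close> this has period
  \<open>k\<close> in \<open>i\<close>, so the second half of the list repeats the first.
\<close>

lemma even_count_relator:
  assumes "s \<in> S" "t \<in> S" "m s t = enat k"
  shows "even (count_list (refl_list (concat (replicate k [s, t]))) r)"
proof -
  let ?f = "\<lambda>i :: nat. (s \<otimes> t) [^] i \<otimes> s"
  have st: "s \<otimes> t \<in> carrier W" using assms gen_carrier by auto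
  have periodic: "?f (i + k) = ?f i" for i
    using coxeter_relation [OF assms] st by (simp add: nat_pow_mult [symmetric])
  have "[0..<2 * k] = [0..<k] @ map (\<lambda>i. i + k) [0..<k]"
    using upt_add_eq_append [of 0 k k] by (simp add: map_add_upt mult_2)
  then have "map ?f [0..<2 * k] = map ?f [0..<k] @ map ?f [0..<k]"
    by (simp add: periodic o_def)
  then show ?thesis using assms by (simp add: refl_list_alternating)
qed

text \<open>
  Since generators are involutions, the signs in a group word do not affect its value and can be
  dropped. A free cancellation then removes a pair \<open>s s\<close>, which contributes the same reflection
  twice and leaves the later ones as they are; a relator contributes each reflection an even
  number of times.
\<close>

lemma word_equiv_odd_count:
  assumes "word_equiv S (coxeter_relators S m) x y"
  shows "word_prod (map fst x) = word_prod (map fst y) \<and>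
    (\<forall>t \<in> carrier W. odd (count_list (refl_list (map fst x)) t) \<longleftrightarrow>
                     odd (count_list (refl_list (map fst y)) t))"
  using assms
proof induction
  case (cancel x y s b)
  then have S: "set (map fst x) \<subseteq> S" "set (map fst y) \<subseteq> S"
    by (auto simp: group_words_def)
  have "refl_list ([s, s] @ map fst y) = [s, s] @ map (conj_by \<one>) (refl_list (map fst y))"
    using cancel S by (subst refl_list_append) (auto simp: gen_involution gen_carrier)
  also have "map (conj_by \<one>) (refl_list (map fst y)) = refl_list (map fst y)"
    using refl_list_closed [OF S(2)] by (auto intro!: map_idI)
  finally show ?case using cancel S
    by (simp add: word_prod_append count_refl_list_append gen_carrier)
next
  case (relator x y r)
  from relator(3) obtain s t k where st: "s \<in> S" "t \<in> S" "m s t = enat k"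
    and r: "r = concat (replicate k [(s, True), (t, True)])"
    by (auto simp: coxeter_relators_def)
  let ?r = "concat (replicate k [s, t])"
  have r': "map fst r = ?r" by (simp add: r map_concat)
  have S: "set (map fst x) \<subseteq> S" "set (map fst y) \<subseteq> S" "set ?r \<subseteq> S"
    using relator(1,2) st by (auto simp: group_words_def)
  have "word_prod ?r = \<one>" using st by (simp add: word_prod_alternating coxeter_relation)
  then show ?case using S st even_count_relator [OF st]
    by (simp add: r' word_prod_append count_refl_list_append del: foldr_append set_concat set_map)
qed auto

lemma odd_count_invariant:
  assumes "set x \<subseteq> S" "set y \<subseteq> S" "word_prod x = word_prod y" "t \<in> carrier W"
  shows "odd (count_list (refl_list x) t) \<longleftrightarrow> odd (count_list (refl_list y) t)"
proof -
  let ?p = "map (\<lambda>s. (s, True))"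
  have "word_eval W (?p x) = word_prod x" for x by (induction x) (auto simp: word_eval_def)
  moreover have "?p x \<in> group_words S" "?p y \<in> group_words S"
    using assms by (auto simp: group_words_def)
  ultimately have "word_equiv S (coxeter_relators S m) (?p x) (?p y)"
    using presentation assms(3) unfolding has_presentation_def by metis
  from word_equiv_odd_count [OF this] assms show ?thesis by (simp add: o_def)
qed

section \<open>Parabolic subgroups and reduced words\<close>

lemma generate_eq_words:
  assumes "J \<subseteq> S"
  shows "generate W J = {word_prod x | x. set x \<subseteq> J}"
proof
  show "generate W J \<subseteq> {word_prod x | x. set x \<subseteq> J}"
  proof
    fix g assume "g \<in> generate W J"
    then show "g \<in> {word_prod x | x. set x \<subseteq> J}"
    proof induction
      case one
      show ?case by (intro CollectI exI [of _ "[]"]) simp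
    next
      case (incl h)
      then show ?case using assms gen_carrier by (intro CollectI exI [of _ "[h]"]) auto
    next
      case (inv h)
      then show ?case using assms gen_carrier by (intro CollectI exI [of _ "[h]"]) auto
    next
      case (eng g h)
      then obtain x y where "set x \<subseteq> J" "set y \<subseteq> J" "g = word_prod x" "h = word_prod y"
        by blast
      then have "g \<otimes> h = word_prod (x @ y)" "set (x @ y) \<subseteq> J"
        using assms word_prod_append [of x y] by auto
      then show ?case by blast
    qed
  qed
  have "word_prod x \<in> generate W J" if "set x \<subseteq> J" for x
    using that by (induction x) (auto intro: generate.intros)
  then show "{word_prod x | x. set x \<subseteq> J} \<subseteq> generate W J" by auto
qed

lemma carrier_eq_words: "carrier W = {word_prod x | x. set x \<subseteq> S}"
  using generate_eq_words [of S] presentation by (auto simp: has_presentation_def)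

lemma parabolic_subgroup: "J \<subseteq> S \<Longrightarrow> subgroup (generate W J) W"
  using gen_carrier by (intro generate_is_subgroup) auto

lemma parabolic_carrier: "J \<subseteq> S \<Longrightarrow> y \<in> generate W J \<Longrightarrow> y \<in> carrier W"
  using subgroup.mem_carrier [OF parabolic_subgroup] .

lemma parabolic_conj_by:
  "J \<subseteq> S \<Longrightarrow> g \<in> generate W J \<Longrightarrow> t \<in> generate W J \<Longrightarrow> conj_by g t \<in> generate W J"
  unfolding conj_by_def
  by (meson parabolic_subgroup subgroup.m_closed subgroup.m_inv_closed)

text \<open>
  Left multiplication of \<open>s\<^sub>1 \<dots> s\<^sub>n\<close> by its \<open>i\<close>-th reflection deletes the letter \<open>s\<^sub>i\<close>.
\<close>

lemma word_deletion:
  "set x \<subseteq> S \<Longrightarrow> t \<in> set (refl_list x) \<Longrightarrow>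
    \<exists>y. set y \<subseteq> set x \<and> length y < length x \<and> word_prod y = t \<otimes> word_prod x"
proof (induction x arbitrary: t)
  case (Cons s x)
  show ?case
  proof (cases "t = s")
    case True
    then show ?thesis using Cons.prems by (intro exI [of _ x]) auto
  next
    case False
    then obtain t' where t': "t' \<in> set (refl_list x)" "t = conj_by s t'"
      using Cons.prems by auto
    obtain y where y: "set y \<subseteq> set x" "length y < length x"
      "word_prod y = t' \<otimes> word_prod x" using Cons.IH [OF _ t'(1)] Cons.prems by auto
    have "t' \<in> carrier W" using t' Cons.prems refl_list_closed [of x] by auto
    then have "word_prod (s # y) = t \<otimes> word_prod (s # x)"
      using y t' Cons.prems by (simp add: conj_by_mult_right gen_carrier)
    then show ?thesis using y by (intro exI [of _ "s # y"]) auto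
  qed
qed simp

text \<open>
  If the same reflection belongs to two positions, both letters can be deleted without
  changing the product, because reflections are involutions.
\<close>

lemma word_shorten:
  "set x \<subseteq> S \<Longrightarrow> \<not> distinct (refl_list x) \<Longrightarrow>
    \<exists>y. set y \<subseteq> set x \<and> length y < length x \<and> word_prod y = word_prod x"
proof (induction x)
  case (Cons s x)
  have s: "s \<in> carrier W" and x: "set (refl_list x) \<subseteq> carrier W"
    using Cons.prems gen_carrier refl_list_closed by auto
  show ?case
  proof (cases "distinct (refl_list x)")
    case False
    obtain y where "set y \<subseteq> set x" "length y < length x" "word_prod y = word_prod x"
      using Cons.IH [OF _ False] Cons.prems by auto
    then show ?thesis by (intro exI [of _ "s # y"]) auto
  next
    case True
    have "inj_on (conj_by s) (set (refl_list x))"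
      using x s by (intro inj_on_inverseI [of _ "conj_by (inv s)"]) auto
    then have "distinct (map (conj_by s) (refl_list x))" using True by (simp add: distinct_map)
    then have "s \<in> conj_by s ` set (refl_list x)" using Cons.prems by simp
    then obtain t where t: "t \<in> set (refl_list x)" "conj_by s t = s" by fastforce
    then have "t = conj_by (inv s) s" using conj_by_eq_iff [of s t s] x s by blast
    then have "s \<in> set (refl_list x)" using t(1) conj_by_inv_self [OF s] by metis
    from word_deletion [OF _ this] Cons.prems obtain y where
      "set y \<subseteq> set x" "length y < length x" "word_prod y = s \<otimes> word_prod x" by auto
    then show ?thesis by (intro exI [of _ y]) auto
  qed
qed simp

text \<open>
  A word in \<open>J\<close> that is shortest among the words in \<open>J\<close> for its product has pairwise distinct
  reflections. Distinctness does not mention \<open>J\<close>, and it makes the length of the word the number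
  of inversions, so such a word is reduced in \<open>S\<close> as well.
\<close>

lemma reduced_word_exists:
  assumes J: "J \<subseteq> S" and y: "y \<in> generate W J"
  obtains x where "set x \<subseteq> J" "word_prod x = y" "distinct (refl_list x)"
proof -
  let ?P = "\<lambda>x. set x \<subseteq> J \<and> word_prod x = y"
  obtain x0 where "?P x0" using y generate_eq_words [OF J] by auto
  then obtain x where x: "?P x" and min: "\<And>z. ?P z \<Longrightarrow> length x \<le> length z"
    using ex_has_least_nat [of ?P x0 length] by blast
  have "distinct (refl_list x)"
  proof (rule ccontr)
    assume "\<not> distinct (refl_list x)"
    with x J obtain z where "set z \<subseteq> set x" "length z < length x" "word_prod z = word_prod x"
      using word_shorten [of x] by blast
    with x min [of z] show False by auto
  qed
  with x that show ?thesis by blast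
qed

section \<open>The inversion cocycle and the length function\<close>

text \<open>
  The existential over words may be read as a universal one, by the invariance of the parity.
\<close>

definition inversions :: "'a \<Rightarrow> 'a set" where
  "inversions w = {t. \<exists>x. set x \<subseteq> S \<and> word_prod x = w \<and> odd (count_list (refl_list x) t)}"

lemma inversions_word:
  assumes "set x \<subseteq> S"
  shows "inversions (word_prod x) = {t. odd (count_list (refl_list x) t)}"
proof (rule Set.set_eqI)
  fix t
  have mem: "t \<in> carrier W" if "odd (count_list (refl_list y) t)" "set y \<subseteq> S" for y
  proof -
    have "t \<in> set (refl_list y)" using that(1) by (rule contrapos_pp) (simp add: count_notin)
    then show ?thesis using refl_list_closed [OF that(2)] by auto
  qed
  show "t \<in> inversions (word_prod x) \<longleftrightarrow> t \<in> {t. odd (count_list (refl_list x) t)}"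
  proof
    assume "t \<in> inversions (word_prod x)"
    then obtain y where y: "set y \<subseteq> S" "word_prod y = word_prod x" "odd (count_list (refl_list y) t)"
      unfolding inversions_def by blast
    then show "t \<in> {t. odd (count_list (refl_list x) t)}"
      using odd_count_invariant [OF y(1) assms y(2) mem [OF y(3,1)]] y(3) by simp
  qed (use assms inversions_def in blast)
qed

lemma inversions_subset_refl_list:
  assumes "set x \<subseteq> S"
  shows "inversions (word_prod x) \<subseteq> set (refl_list x)"
proof
  fix t assume "t \<in> inversions (word_prod x)"
  then have "odd (count_list (refl_list x) t)" using assms by (simp add: inversions_word)
  then show "t \<in> set (refl_list x)" by (rule contrapos_pp) (simp add: count_notin)
qed

lemma inversions_reduced_word:
  assumes "set x \<subseteq> S" "distinct (refl_list x)"
  shows "inversions (word_prod x) = set (refl_list x)"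
proof -
  have "distinct l \<Longrightarrow> odd (count_list l t) \<longleftrightarrow> t \<in> set l" for l and t :: 'a
    by (induction l) auto
  then show ?thesis using assms by (simp add: inversions_word)
qed

lemma reduced_word_of_element:
  assumes "w \<in> carrier W"
  obtains x where "set x \<subseteq> S" "word_prod x = w" "distinct (refl_list x)"
    "inversions w = set (refl_list x)"
proof -
  have "w \<in> generate W S" using assms presentation by (simp add: has_presentation_def)
  then obtain x where x: "set x \<subseteq> S" "word_prod x = w" "distinct (refl_list x)"
    using reduced_word_exists [OF subset_refl] by blast
  then show ?thesis using that inversions_reduced_word [OF x(1,3)] by simp
qed

lemma inversions_carrier:
  assumes "w \<in> carrier W"
  shows "inversions w \<subseteq> carrier W"
proof -
  obtain x where "set x \<subseteq> S" "inversions w = set (refl_list x)"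
    using reduced_word_of_element [OF assms] .
  then show ?thesis using refl_list_closed by simp
qed

lemma finite_inversions:
  assumes "w \<in> carrier W"
  shows "finite (inversions w)"
  using reduced_word_of_element [OF assms] by (metis List.finite_set)

lemma inversions_one: "inversions \<one> = {}"
  using inversions_word [of "[]"] by simp

lemma inversions_gen: "s \<in> S \<Longrightarrow> inversions s = {s}"
  using inversions_reduced_word [of "[s]"] gen_carrier by simp

lemma inversions_mult:
  assumes "a \<in> carrier W" "b \<in> carrier W" "t \<in> carrier W"
  shows "t \<in> inversions (a \<otimes> b) \<longleftrightarrow> (t \<in> inversions a) \<noteq> (conj_by (inv a) t \<in> inversions b)"
proof -
  obtain x y where xy: "set x \<subseteq> S" "a = word_prod x" "set y \<subseteq> S" "b = word_prod y"
    using assms carrier_eq_words by auto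
  then have "inversions (a \<otimes> b) = {t. odd (count_list (refl_list (x @ y)) t)}"
    using inversions_word [of "x @ y"] by (simp add: word_prod_append del: foldr_append)
  then show ?thesis using xy assms by (simp add: inversions_word count_refl_list_append)
qed

lemma cox_length_le:
  assumes "set x \<subseteq> S"
  shows "cox_length W S (word_prod x) \<le> length x"
  unfolding cox_length_def using assms by (intro Least_le) auto

lemma cox_length_eq_card:
  assumes "w \<in> carrier W"
  shows "cox_length W S w = card (inversions w)"
  unfolding cox_length_def
proof (rule Least_equality)
  obtain x where "set x \<subseteq> S" "word_prod x = w" "distinct (refl_list x)"
    "inversions w = set (refl_list x)"
    using reduced_word_of_element [OF assms] .
  then show "\<exists>x. set x \<subseteq> S \<and> length x = card (inversions w) \<and> word_prod x = w"
    by (intro exI [of _ x]) (simp add: distinct_card)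
next
  fix n assume "\<exists>x. set x \<subseteq> S \<and> length x = n \<and> word_prod x = w"
  then obtain x where x: "set x \<subseteq> S" "length x = n" "word_prod x = w" by blast
  have "card (inversions w) \<le> card (set (refl_list x))"
    using inversions_subset_refl_list x by (intro card_mono) auto
  also have "\<dots> \<le> n" using card_length [of "refl_list x"] x by simp
  finally show "card (inversions w) \<le> n" .
qed

lemma cox_length_reduced_word:
  "set x \<subseteq> S \<Longrightarrow> distinct (refl_list x) \<Longrightarrow> cox_length W S (word_prod x) = length x"
  by (simp add: cox_length_eq_card inversions_reduced_word distinct_card)

lemma cox_length_eq_0:
  assumes "w \<in> carrier W" "cox_length W S w = 0"
  shows "w = \<one>"
proof -
  obtain x where x: "set x \<subseteq> S" "word_prod x = w" "distinct (refl_list x)"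
    using reduced_word_of_element [OF assms(1)] .
  then have "length x = 0" using assms(2) cox_length_reduced_word [OF x(1,3)] by simp
  then show ?thesis using x(2) by simp
qed

section \<open>Inversions are the reflections that shorten\<close>

lemma reflectionE:
  assumes "t \<in> reflections W S"
  obtains g s where "g \<in> carrier W" "s \<in> S" "t = conj_by g s"
  using assms by (auto simp: reflections_def conj_by_def)

lemma reflectionI: "g \<in> carrier W \<Longrightarrow> s \<in> S \<Longrightarrow> conj_by g s \<in> reflections W S"
  unfolding reflections_def conj_by_def by blast

lemma refl_list_reflections: "set x \<subseteq> S \<Longrightarrow> set (refl_list x) \<subseteq> reflections W S"
proof (induction x)
  case (Cons s x)
  have s: "s \<in> S" "s \<in> carrier W" using Cons.prems gen_carrier by auto
  have "conj_by \<one> s \<in> reflections W S" using s(1) by (intro reflectionI) auto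
  moreover have "conj_by s t \<in> reflections W S" if "t \<in> reflections W S" for t
  proof -
    from that obtain g r where g: "g \<in> carrier W" "r \<in> S" "t = conj_by g r" by (rule reflectionE)
    then have "conj_by s t = conj_by (s \<otimes> g) r" using s by (simp add: conj_by_mult gen_carrier)
    then show ?thesis using g s reflectionI [of "s \<otimes> g" r] by simp
  qed
  ultimately show ?case using Cons s by auto
qed simp

lemma inversions_reflections:
  assumes "w \<in> carrier W"
  shows "inversions w \<subseteq> reflections W S"
proof -
  obtain x where "set x \<subseteq> S" "inversions w = set (refl_list x)"
    using reduced_word_of_element [OF assms] .
  then show ?thesis using refl_list_reflections by simp
qed

text \<open>
  Expand \<open>N(g s g\<inverse>)\<close> by the cocycle identity: membership of \<open>t = g s g\<inverse>\<close> gets one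
  contribution from \<open>s \<in> N(s)\<close> and two equal ones from \<open>N(g)\<close> and \<open>N(g\<inverse>)\<close>, which cancel.
\<close>

lemma reflection_inversion_self:
  assumes "t \<in> reflections W S"
  shows "t \<in> inversions t"
proof -
  obtain g s where gs: "g \<in> carrier W" "s \<in> S" "t = conj_by g s"
    using assms by (rule reflectionE)
  have s: "s \<in> carrier W" using gs gen_carrier by auto
  have "s \<in> inversions (inv g \<otimes> g) \<longleftrightarrow> (s \<in> inversions (inv g)) \<noteq> (t \<in> inversions g)"
    using inversions_mult [of "inv g" g s] gs s by simp
  then have inv: "s \<in> inversions (inv g) \<longleftrightarrow> t \<in> inversions g"
    using gs by (simp add: inversions_one)
  have "s \<in> inversions (s \<otimes> inv g) \<longleftrightarrow> \<not> t \<in> inversions g"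
    using inversions_mult [of s "inv g" s] gs s inv by (simp add: inversions_gen)
  moreover have "g \<otimes> (s \<otimes> inv g) = t" using gs s by (simp add: conj_by_def m_assoc)
  ultimately show ?thesis
    using inversions_mult [of g "s \<otimes> inv g" t] gs s by simp
qed

lemma reflection_carrier: "t \<in> reflections W S \<Longrightarrow> t \<in> carrier W"
  by (auto elim!: reflectionE simp: gen_carrier)

lemma reflection_involution:
  assumes "t \<in> reflections W S"
  shows "t \<otimes> t = \<one>"
proof -
  obtain g s where gs: "g \<in> carrier W" "s \<in> S" "t = conj_by g s"
    using assms by (rule reflectionE)
  have s: "s \<in> carrier W" using gs(2) gen_carrier by simp
  have "t = g \<otimes> (s \<otimes> inv g)" using gs s by (simp add: conj_by_def m_assoc)
  then have "t \<otimes> t = g \<otimes> (s \<otimes> (s \<otimes> inv g))"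
    using conj_by_mult_right [of g s "s \<otimes> inv g"] gs s by simp
  then show ?thesis using gs by simp
qed

lemma inversion_shortens:
  assumes "w \<in> carrier W" "t \<in> inversions w"
  shows "cox_length W S (t \<otimes> w) < cox_length W S w"
proof -
  obtain x where x: "set x \<subseteq> S" "word_prod x = w" "distinct (refl_list x)"
    "inversions w = set (refl_list x)"
    using reduced_word_of_element [OF assms(1)] .
  then obtain y where y: "set y \<subseteq> set x" "length y < length x" "word_prod y = t \<otimes> w"
    using word_deletion [of x t] assms(2) by auto
  then have "cox_length W S (t \<otimes> w) \<le> length y" using cox_length_le [of y] x(1) by auto
  then show ?thesis using cox_length_reduced_word [OF x(1,3)] x(2) y(2) by simp
qed

text \<open>
  A reflection \<open>t \<notin> N(w)\<close> lies in \<open>N(t w)\<close>, because \<open>t \<in> N(t)\<close>; hence it shortens \<open>t w\<close> to \<open>w\<close>,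
  and so it lengthens \<open>w\<close>.
\<close>

lemma left_inversions_eq:
  assumes "w \<in> carrier W"
  shows "left_inversions W S w = inversions w"
proof -
  have "t \<in> inversions w"
    if t: "t \<in> reflections W S" "cox_length W S (t \<otimes> w) < cox_length W S w" for t
  proof (rule ccontr)
    assume "t \<notin> inversions w"
    moreover have tc: "t \<in> carrier W" using t reflection_carrier by auto
    ultimately have "t \<in> inversions (t \<otimes> w)"
      using inversions_mult [of t w t] reflection_inversion_self [OF t(1)] assms by simp
    then have "cox_length W S (t \<otimes> (t \<otimes> w)) < cox_length W S (t \<otimes> w)"
      using inversion_shortens assms tc by simp
    moreover have "t \<otimes> (t \<otimes> w) = w"
      using reflection_involution [OF t(1)] tc assms by (simp add: m_assoc [symmetric])
    ultimately show False using t by simp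
  qed
  then show ?thesis
    using assms inversions_reflections inversion_shortens by (auto simp: left_inversions_def)
qed

text \<open>
  Here \<open>N(u s)\<close> is \<open>N(u)\<close> with \<open>u s u\<inverse>\<close> toggled. That reflection takes \<open>u\<close> to the longer element
  \<open>v = u s\<close>, so it was not in \<open>N(u)\<close> before.
\<close>

lemma weak_cover_inversions:
  assumes "right_weak_covers W S u v"
  shows "inversions u \<subseteq> inversions v"
proof
  fix t assume t: "t \<in> inversions u"
  define s where "s = inv u \<otimes> v"
  have u: "u \<in> carrier W" "v \<in> carrier W" "s \<in> S" "cox_length W S u < cox_length W S v"
    using assms by (auto simp: right_weak_covers_def s_def)
  then have v: "v = u \<otimes> s" by (simp add: s_def m_assoc [symmetric])
  have tc: "t \<in> carrier W" using t u inversions_carrier by auto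
  have sc: "s \<in> carrier W" using u gen_carrier by auto
  have "t \<noteq> conj_by u s"
  proof
    assume "t = conj_by u s"
    then have "t \<otimes> u = v" using u sc v by (simp add: conj_by_def m_assoc)
    then show False using inversion_shortens [OF u(1) t] u by simp
  qed
  then show "t \<in> inversions v"
    using t u tc sc v by (auto simp: inversions_mult inversions_gen)
qed

lemma weak_le_inversions: "right_weak_le W S u v \<Longrightarrow> inversions u \<subseteq> inversions v"
  unfolding right_weak_le_def
  by (induction rule: rtranclp_induct) (use weak_cover_inversions in blast)+

section \<open>Letters of reduced words in parabolic subgroups\<close>

lemma inversions_parabolic:
  assumes J: "J \<subseteq> S" and y: "y \<in> generate W J"
  shows "inversions y \<subseteq> generate W J"
proof -
  have "set (refl_list x) \<subseteq> generate W J" if "set x \<subseteq> J" for x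
    using that by (induction x) (auto intro: generate.incl parabolic_conj_by [OF J])
  moreover obtain x where "set x \<subseteq> J" "word_prod x = y"
    using assms generate_eq_words by auto
  ultimately show ?thesis using inversions_subset_refl_list [of x] J by blast
qed

lemma parabolic_gen:
  assumes J: "J \<subseteq> S" and s: "s \<in> S" "s \<in> generate W J"
  shows "s \<in> J"
proof -
  obtain x where x: "set x \<subseteq> J" "word_prod x = s" "distinct (refl_list x)"
    using reduced_word_exists [OF J s(2)] .
  have "length x = cox_length W S s" using cox_length_reduced_word [of x] x J by auto
  also have "\<dots> = 1" using s by (simp add: cox_length_eq_card gen_carrier inversions_gen)
  finally obtain a where "x = [a]" by (auto simp: length_Suc_conv)
  then show ?thesis using x J gen_carrier by auto
qed

text \<open>
  The inversions \<open>t\<^sub>i\<close> of an element of \<open>W\<^sub>J\<close> lie in \<open>W\<^sub>J\<close>. Since \<open>t\<^sub>i\<close> is the conjugate of \<open>s\<^sub>i\<close> by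
  \<open>s\<^sub>1 \<dots> s\<^sub>i\<^sub>-\<^sub>1\<close>, the letters \<open>s\<^sub>1, s\<^sub>2, \<dots>\<close> are found to be in \<open>W\<^sub>J\<close> one after the other.
\<close>

lemma reduced_word_letters:
  assumes J: "J \<subseteq> S" and x: "set x \<subseteq> S" "distinct (refl_list x)" "word_prod x \<in> generate W J"
  shows "set x \<subseteq> J"
proof -
  have "set x \<subseteq> generate W J" if "set x \<subseteq> S" "set (refl_list x) \<subseteq> generate W J" for x
    using that
  proof (induction x)
    case (Cons s x)
    have "t \<in> generate W J" if "t \<in> set (refl_list x)" for t
    proof -
      have "t \<in> carrier W" using that Cons.prems refl_list_closed [of x] by auto
      then have "conj_by s (conj_by s t) = t"
        using Cons.prems by (simp add: conj_by_mult [symmetric] gen_carrier gen_involution)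
      then show ?thesis using that Cons.prems parabolic_conj_by [OF J, of s "conj_by s t"] by auto
    qed
    with Cons show ?case by auto
  qed simp
  moreover have "set (refl_list x) \<subseteq> generate W J"
    using inversions_parabolic [OF J x(3)] inversions_reduced_word [OF x(1,2)] by simp
  ultimately have "set x \<subseteq> generate W J" using x(1) by blast
  then show ?thesis using parabolic_gen [OF J] x by blast
qed

text \<open>
  One reduced word of \<open>r\<close> serves for all \<open>s\<close> at once: none of its letters is in \<open>D\<close>.
\<close>

lemma parabolic_Inter:
  assumes r: "r \<in> carrier W" and D: "\<And>s. s \<in> D \<Longrightarrow> r \<in> generate W (S - {s})"
  shows "r \<in> generate W (S - D)"
proof -
  obtain x where x: "set x \<subseteq> S" "word_prod x = r" "distinct (refl_list x)"
    using reduced_word_of_element [OF r] .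
  have "set x \<subseteq> S - {s}" if "s \<in> D" for s
    using reduced_word_letters [of "S - {s}" x] x D [OF that] by auto
  then have "set x \<subseteq> S - D" using x by blast
  then show ?thesis using generate_eq_words [of "S - D"] x by auto
qed

section \<open>Minimal coset representatives\<close>

definition coset_minimal :: "'a set \<Rightarrow> 'a \<Rightarrow> bool" where
  "coset_minimal J x \<longleftrightarrow>
     x \<in> carrier W \<and> (\<forall>y \<in> generate W J. cox_length W S x \<le> cox_length W S (x \<otimes> y))"

text \<open>
  If \<open>t \<in> N(x)\<close> were of the form \<open>x q x\<inverse>\<close> with \<open>q \<in> N(y) \<subseteq> W\<^sub>J\<close>, then \<open>t x = x q\<close> would be an
  element of \<open>x W\<^sub>J\<close> shorter than \<open>x\<close>. So nothing cancels in the cocycle identity.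
\<close>

lemma coset_minimal_inversions:
  assumes J: "J \<subseteq> S" and x: "coset_minimal J x" and y: "y \<in> generate W J"
  shows "inversions x \<inter> conj_by x ` inversions y = {}"
    and "inversions (x \<otimes> y) = inversions x \<union> conj_by x ` inversions y"
proof -
  have xc: "x \<in> carrier W" using x by (simp add: coset_minimal_def)
  have yc: "y \<in> carrier W" using parabolic_carrier [OF J y] .
  have qc: "q \<in> carrier W" if "q \<in> inversions y" for q
    using that inversions_carrier yc by auto
  show disj: "inversions x \<inter> conj_by x ` inversions y = {}"
  proof (rule ccontr)
    assume "\<not> ?thesis"
    then obtain q where q: "q \<in> inversions y" "conj_by x q \<in> inversions x" by auto
    have "conj_by x q \<otimes> x = x \<otimes> q" using xc qc [OF q(1)] by (simp add: conj_by_def m_assoc)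
    then have "cox_length W S (x \<otimes> q) < cox_length W S x"
      using inversion_shortens [OF xc q(2)] by simp
    moreover have "q \<in> generate W J" using inversions_parabolic [OF J y] q by auto
    ultimately show False using x unfolding coset_minimal_def by (meson not_less)
  qed
  have *: "t \<in> conj_by x ` inversions y \<longleftrightarrow> conj_by (inv x) t \<in> inversions y"
    if "t \<in> carrier W" for t
  proof
    assume "conj_by (inv x) t \<in> inversions y"
    then have "conj_by x (conj_by (inv x) t) \<in> conj_by x ` inversions y" by (rule imageI)
    then show "t \<in> conj_by x ` inversions y" using that xc by simp
  next
    assume "t \<in> conj_by x ` inversions y"
    then obtain q where "q \<in> inversions y" "t = conj_by x q" by (rule imageE)
    then show "conj_by (inv x) t \<in> inversions y" using xc qc by simp
  qed
  show "inversions (x \<otimes> y) = inversions x \<union> conj_by x ` inversions y"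
  proof (rule Set.set_eqI)
    fix t
    show "t \<in> inversions (x \<otimes> y) \<longleftrightarrow> t \<in> inversions x \<union> conj_by x ` inversions y"
    proof (cases "t \<in> carrier W")
      case True
      then show ?thesis using inversions_mult [OF xc yc True] * [OF True] disj by blast
    next
      case False
      then have "t \<notin> conj_by x ` inversions y" using qc xc by auto
      moreover have "t \<notin> inversions (x \<otimes> y)" "t \<notin> inversions x"
        using False inversions_carrier [of "x \<otimes> y"] inversions_carrier [of x] xc yc by auto
      ultimately show ?thesis by simp
    qed
  qed
qed

lemma coset_minimal_length:
  assumes J: "J \<subseteq> S" and x: "coset_minimal J x" and y: "y \<in> generate W J"
  shows "cox_length W S (x \<otimes> y) = cox_length W S x + cox_length W S y"
proof -
  have xc: "x \<in> carrier W" using x by (simp add: coset_minimal_def)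
  have yc: "y \<in> carrier W" using parabolic_carrier [OF J y] .
  have "inj_on (conj_by x) (inversions y)"
    using xc inversions_carrier [OF yc] by (intro inj_on_inverseI [of _ "conj_by (inv x)"]) auto
  then show ?thesis
    using coset_minimal_inversions [OF assms] xc yc
    by (simp add: cox_length_eq_card card_Un_disjoint finite_inversions card_image)
qed

lemma coset_minimal_exists:
  assumes J: "J \<subseteq> S" and w: "w \<in> carrier W"
  obtains x y where "coset_minimal J x" "y \<in> generate W J" "w = x \<otimes> y"
proof -
  note sg = parabolic_subgroup [OF J]
  obtain z where z: "z \<in> generate W J"
    and min: "\<And>z'. z' \<in> generate W J \<Longrightarrow> cox_length W S (w \<otimes> z) \<le> cox_length W S (w \<otimes> z')"
    using ex_has_least_nat [of "\<lambda>z. z \<in> generate W J" \<one> "\<lambda>z. cox_length W S (w \<otimes> z)"]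
      generate.one by blast
  have zc: "z \<in> carrier W" using parabolic_carrier [OF J z] .
  have "coset_minimal J (w \<otimes> z)"
    using w zc min subgroup.m_closed [OF sg z] parabolic_carrier [OF J]
    by (auto simp: coset_minimal_def m_assoc)
  moreover have "inv z \<in> generate W J" using subgroup.m_inv_closed [OF sg z] .
  moreover have "w = w \<otimes> z \<otimes> inv z" using w zc by (simp add: m_assoc)
  ultimately show ?thesis using that by blast
qed

lemma min_coset_rep_eq:
  assumes J: "J \<subseteq> S" and x: "coset_minimal J x" and y: "y \<in> generate W J"
  shows "min_coset_rep W S J (x \<otimes> y) = x"
  unfolding min_coset_rep_def
proof (rule the_equality)
  note sg = parabolic_subgroup [OF J]
  have xc: "x \<in> carrier W" using x by (simp add: coset_minimal_def)
  have yc: "y \<in> carrier W" using parabolic_carrier [OF J y] .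
  have coset: "(x \<otimes> y) <#\<^bsub>W\<^esub> generate W J = (\<lambda>z. x \<otimes> z) ` generate W J"
  proof -
    have "(x \<otimes> y) <#\<^bsub>W\<^esub> generate W J = x <#\<^bsub>W\<^esub> (y <#\<^bsub>W\<^esub> generate W J)"
      using xc yc subgroup.subset [OF sg] by (simp add: lcos_m_assoc)
    also have "y <#\<^bsub>W\<^esub> generate W J = generate W J"
      using y sg by (simp add: coset_join3 yc)
    finally show ?thesis by (auto simp: l_coset_def)
  qed
  have "x = x \<otimes> \<one>" using xc by simp
  then show "x \<in> (x \<otimes> y) <#\<^bsub>W\<^esub> generate W J \<and>
      (\<forall>y\<in>(x \<otimes> y) <#\<^bsub>W\<^esub> generate W J. cox_length W S x \<le> cox_length W S y)"
    using x generate.one [of W J] unfolding coset coset_minimal_def by blast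
  fix x' assume "x' \<in> (x \<otimes> y) <#\<^bsub>W\<^esub> generate W J \<and>
      (\<forall>y\<in>(x \<otimes> y) <#\<^bsub>W\<^esub> generate W J. cox_length W S x' \<le> cox_length W S y)"
  then obtain z where z: "z \<in> generate W J" "x' = x \<otimes> z"
    and "cox_length W S x' \<le> cox_length W S (x \<otimes> \<one>)"
    using generate.one [of W J] unfolding coset by blast
  then have "cox_length W S z = 0"
    using coset_minimal_length [OF J x z(1)] xc by simp
  then show "x' = x" using cox_length_eq_0 parabolic_carrier [OF J z(1)] z xc by simp
qed

text \<open>
  Write \<open>w = x y\<close> with \<open>x\<close> minimal in the coset and \<open>y \<in> W\<^sub>J\<close>, and take a word in \<open>J\<close> for \<open>y\<close> that
  is reduced in \<open>S\<close>. If it had a last letter \<open>s \<in> J\<close>, then \<open>\<ell>(y s) < \<ell>(y)\<close>; as \<open>\<ell>(x z) = \<ell>(x) + \<ell>(z)\<close>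
  for all \<open>z \<in> W\<^sub>J\<close>, this \<open>s\<close> would be a descent of \<open>w\<close>. So the word is empty and \<open>w = x\<close>.
\<close>

lemma coset_minimal_if_no_descent:
  assumes J: "J \<subseteq> S" and w: "w \<in> carrier W" and no: "J \<inter> right_descents W S w = {}"
  shows "coset_minimal J w"
proof -
  obtain x y where x: "coset_minimal J x" and y: "y \<in> generate W J" and xy: "w = x \<otimes> y"
    using coset_minimal_exists [OF J w] .
  have xc: "x \<in> carrier W" using x by (simp add: coset_minimal_def)
  obtain z where z: "set z \<subseteq> J" "word_prod z = y" "distinct (refl_list z)"
    using reduced_word_exists [OF J y] .
  show ?thesis
  proof (cases z rule: rev_cases)
    case Nil
    then have "y = \<one>" using z(2) by simp
    then show ?thesis using x xy xc by simp
  next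
    case (snoc z' s)
    have S: "set z' \<subseteq> S" "s \<in> S" "s \<in> J" "set z' \<subseteq> J" using snoc z J by auto
    then have y': "y = word_prod z' \<otimes> s"
      using z(2) snoc by (simp add: word_prod_append gen_carrier del: foldr_append)
    have ys: "y \<otimes> s = word_prod z'" using S by (simp add: y' m_assoc gen_carrier gen_involution)
    have mem: "y \<otimes> s \<in> generate W J" using ys S generate_eq_words [OF J] by auto
    have "set z \<subseteq> S" using z(1) J by blast
    then have "cox_length W S y = length z" using cox_length_reduced_word [of z] z by metis
    moreover have "cox_length W S (y \<otimes> s) \<le> length z'" using cox_length_le [OF S(1)] ys by simp
    ultimately have "cox_length W S (y \<otimes> s) < cox_length W S y" using snoc by simp
    then have "cox_length W S (x \<otimes> (y \<otimes> s)) < cox_length W S (x \<otimes> y)"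
      using coset_minimal_length [OF J x] y mem by simp
    moreover have "x \<otimes> (y \<otimes> s) = w \<otimes> s"
      using xc parabolic_carrier [OF J y] S by (simp add: xy m_assoc gen_carrier)
    ultimately have "s \<in> right_descents W S w" using S xy by (simp add: right_descents_def)
    then show ?thesis using no S by blast
  qed
qed

lemma min_coset_rep_decomp:
  assumes J: "J \<subseteq> S" and w: "w \<in> carrier W"
  obtains y where "coset_minimal J (min_coset_rep W S J w)" "y \<in> generate W J"
    "w = min_coset_rep W S J w \<otimes> y"
  using coset_minimal_exists [OF J w] min_coset_rep_eq [OF J] by metis

lemma min_coset_rep_inversions:
  assumes J: "J \<subseteq> S" and v: "v \<in> carrier W"
  shows "inversions (min_coset_rep W S J v) \<subseteq> inversions v"
  using min_coset_rep_decomp [OF J v] coset_minimal_inversions(2) [OF J] by (metis Un_upper1)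

text \<open>
  With \<open>v = x y\<close> and \<open>x = v\<^sup>J\<close>, an inversion of \<open>v\<close> that is not one of \<open>x\<close> has the form \<open>x q x\<inverse>\<close>
  with \<open>q \<in> N(y) \<subseteq> W\<^sub>J\<close>, and conjugating it by \<open>v\<inverse>\<close> gives \<open>y\<inverse> q y\<close>.
\<close>

lemma conj_mem_parabolic:
  assumes J: "J \<subseteq> S" and v: "v \<in> carrier W"
    and t: "t \<in> inversions v" "t \<notin> inversions (min_coset_rep W S J v)"
  shows "conj_by (inv v) t \<in> generate W J"
proof -
  define x where "x = min_coset_rep W S J v"
  obtain y where x: "coset_minimal J x" and y: "y \<in> generate W J" and xy: "v = x \<otimes> y"
    using min_coset_rep_decomp [OF J v] unfolding x_def by blast
  have xc: "x \<in> carrier W" using x by (simp add: coset_minimal_def)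
  have yc: "y \<in> carrier W" using parabolic_carrier [OF J y] .
  obtain q where q: "q \<in> inversions y" "t = conj_by x q"
    using t coset_minimal_inversions(2) [OF J x y] by (auto simp: xy [symmetric] x_def [symmetric])
  have qJ: "q \<in> generate W J" using inversions_parabolic [OF J y] q by auto
  have "conj_by (inv v) t = conj_by (inv y) (conj_by (inv x) t)"
    using q parabolic_carrier [OF J qJ] xc yc
    by (simp add: xy inv_mult_group conj_by_mult)
  also have "\<dots> = conj_by (inv y) q" using q parabolic_carrier [OF J qJ] xc by simp
  also have "\<dots> \<in> generate W J"
    using parabolic_conj_by [OF J _ qJ] subgroup.m_inv_closed [OF parabolic_subgroup [OF J] y]
    by blast
  finally show ?thesis .
qed

text \<open>
  The reflection \<open>r = v\<inverse> t v\<close> satisfies \<open>w r = (u\<inverse> t u) w\<close>, which is shorter than \<open>w\<close>. If no \<open>s\<close>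
  were as required, \<open>r\<close> would lie in the parabolic subgroup of the non-descents of \<open>w\<close>, and
  multiplying \<open>w\<close> by an element of that subgroup cannot shorten it.
\<close>

lemma weak_le_new_inversion:
  assumes u: "u \<in> carrier W" and v: "v \<in> carrier W"
    and t: "t \<in> inversions v" "t \<notin> inversions u"
  shows "\<exists>s \<in> right_descents W S (inv u \<otimes> v). t \<in> inversions (min_coset_rep W S (S - {s}) v)"
proof (rule ccontr)
  assume contra: "\<not> ?thesis"
  define w where "w = inv u \<otimes> v"
  define r where "r = conj_by (inv v) t"
  let ?K = "S - right_descents W S w"
  have w: "w \<in> carrier W" and uw: "u \<otimes> w = v" and tc: "t \<in> carrier W"
    using u v t inversions_carrier by (auto simp: w_def m_assoc [symmetric])
  have rc: "r \<in> carrier W" using v tc by (simp add: r_def)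
  have "r \<in> generate W (S - {s})" if "s \<in> right_descents W S w" for s
    using that contra v t conj_mem_parabolic by (auto simp: r_def w_def)
  then have r: "r \<in> generate W ?K" using parabolic_Inter [OF rc] by blast
  have "coset_minimal ?K w" using w by (intro coset_minimal_if_no_descent) auto
  then have "cox_length W S w \<le> cox_length W S (w \<otimes> r)"
    using r by (simp add: coset_minimal_def)
  moreover have "conj_by (inv u) t \<in> inversions w"
    using t inversions_mult [OF u w tc] uw by simp
  then have "cox_length W S (conj_by (inv u) t \<otimes> w) < cox_length W S w"
    using inversion_shortens w by blast
  moreover have "conj_by (inv u) t \<otimes> w = w \<otimes> r"
  proof -
    have "r = conj_by (inv w) (conj_by (inv u) t)"
      using u w tc by (simp add: r_def uw [symmetric] inv_mult_group conj_by_mult)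
    then show ?thesis using conj_by_inv_mult_right [OF w, of "conj_by (inv u) t"] u tc by simp
  qed
  ultimately show False by simp
qed

end

theorem corollary2p2:
  fixes W (structure)
    and S :: "'a set"
    and m :: "'a \<Rightarrow> 'a \<Rightarrow> enat"
    and u v :: 'a
  assumes "coxeter_system W S m"
    and "u \<in> carrier W" and "v \<in> carrier W"
    and "right_weak_le W S u v"
  shows "left_inversions W S v =
    left_inversions W S u \<union>
      (\<Union>s \<in> right_descents W S (inv u \<otimes> v). left_inversions W S (min_coset_rep W S (S - {s}) v))"
proof -
  interpret coxeter_system W S m by fact
  have rep: "min_coset_rep W S (S - {s}) v \<in> carrier W" for s
    using min_coset_rep_decomp [of "S - {s}" v] assms by (auto simp: coset_minimal_def)
  have "inversions (min_coset_rep W S (S - {s}) v) \<subseteq> inversions v" for s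
    using min_coset_rep_inversions assms(3) by simp
  then have "inversions v = inversions u \<union>
      (\<Union>s \<in> right_descents W S (inv u \<otimes> v). inversions (min_coset_rep W S (S - {s}) v))"
    using weak_le_inversions [OF assms(4)] weak_le_new_inversion [OF assms(2,3)] by blast
  then show ?thesis using assms(2,3) by (simp add: left_inversions_eq rep)
qed

end
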